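(* Let $\nu>1$ be an integer and let $C=C(\nu)\in\mathbb{R}^{(\nu+6)\times(\nu+6)}$ be the matrix defined as follows, where $u$ ranges over $\{1,\ldots,\nu+1\}$ and $v$ over $\{1,\ldots,\nu+2\}$: (1) $C_{uv}=\min\{10u+10v-10,\,20u+1,\,20v-9\}$ if $(u,v)\notin\{(\nu,\nu+1),(\nu+1,\nu+1)\}$; (2) $C_{\nu,\nu+1}=20\nu-1$ and $C_{\nu+1,\nu+1}=20\nu+11$; (3) $C_{u,\nu+3}=0$ and $C_{u,\nu+4}=C_{u,\nu+5}=C_{u,\nu+6}=2$; (4) $C_{\nu+2,u}=10u-3$, $C_{\nu+3,u}=11$, $C_{\nu+4,u}=C_{\nu+5,u}=2$, $C_{\nu+6,u}=0$; (5) the submatrix of $C$ with rows and columns $\nu+2,\ldots,\nu+6$ equals $$\begin{pmatrix}0&0&0&0&2\\0&0&2&0&2\\2&2&0&2&2\\0&2&2&0&2\\0&2&2&2&0\end{pmatrix}.$$ Then the factor rank of $C(\nu)$ is greater than $4$.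
   Context: The tropical semiring is $\mathbb{R}$ with $a\oplus b=\min\{a,b\}$ and $a\otimes b=a+b$; $(B\otimes C)_{ij}=\min_{\tau}\{B_{i\tau}+C_{\tau j}\}$. The factor rank of $A\in\mathbb{R}^{m\times n}$ is the smallest $k$ such that $A=B\otimes C$ for some $B\in\mathbb{R}^{m\times k}$, $C\in\mathbb{R}^{k\times n}$. *)

theory Defs
  imports Complex_Main "Jordan_Normal_Form.Matrix"
begin

text \<open>The min-plus product. For inner dimension 0 the minimum below would range over the
  empty set and carry no meaning, so \<open>factor_rank\<close> only admits positive inner dimensions.\<close>

definition trop_mult :: "real mat \<Rightarrow> real mat \<Rightarrow> real mat" (infixl \<open>\<otimes>\<^sub>t\<close> 70) where
  "B \<otimes>\<^sub>t C = mat (dim_row B) (dim_col C)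
     (\<lambda>(i, j). Min ((\<lambda>t. B $$ (i, t) + C $$ (t, j)) ` {0..<dim_col B}))"

definition factor_rank :: "real mat \<Rightarrow> nat" where
  "factor_rank A = (LEAST k. k > 0 \<and>
     (\<exists>B \<in> carrier_mat (dim_row A) k. \<exists>C \<in> carrier_mat k (dim_col A). A = B \<otimes>\<^sub>t C))"

text \<open>The least element above always exists for a matrix with at least one column: \<open>A\<close> is the
  product of itself with a finite surrogate of the tropical identity matrix, which has \<open>0\<close> on
  the diagonal and a large constant elsewhere.\<close>

lemma factor_rank_witness:
  fixes A :: "real mat"
  assumes "dim_col A > 0"
  shows "\<exists>k > 0. \<exists>B \<in> carrier_mat (dim_row A) k. \<exists>C \<in> carrier_mat k (dim_col A). A = B \<otimes>\<^sub>t C"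
proof -
  let ?n = "dim_col A"
  define M where "M = (\<Sum>i<dim_row A. \<Sum>j<?n. \<bar>A $$ (i, j)\<bar>)"
  define J where "J = mat ?n ?n (\<lambda>(i, j). if i = j then 0 else 2 * M)"
  have M: "\<bar>A $$ (i, j)\<bar> \<le> M" if "i < dim_row A" "j < ?n" for i j
  proof -
    have "\<bar>A $$ (i, j)\<bar> \<le> (\<Sum>j<?n. \<bar>A $$ (i, j)\<bar>)"
      using that by (intro member_le_sum) auto
    also have "\<dots> \<le> M"
      unfolding M_def using that
      by (intro member_le_sum[where f = "\<lambda>i. \<Sum>j<?n. \<bar>A $$ (i, j)\<bar>"]) (auto intro: sum_nonneg)
    finally show ?thesis .
  qed
  have "A = A \<otimes>\<^sub>t J"
  proof (rule eq_matI)
    fix i j assume "i < dim_row (A \<otimes>\<^sub>t J)" "j < dim_col (A \<otimes>\<^sub>t J)"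
    hence ij: "i < dim_row A" "j < ?n" by (auto simp: trop_mult_def J_def)
    have "Min ((\<lambda>t. A $$ (i, t) + J $$ (t, j)) ` {0..<?n}) = A $$ (i, j)"
    proof (rule Min_eqI)
      fix y assume "y \<in> (\<lambda>t. A $$ (i, t) + J $$ (t, j)) ` {0..<?n}"
      then obtain t where t: "t < ?n" "y = A $$ (i, t) + J $$ (t, j)" by auto
      show "A $$ (i, j) \<le> y"
        using t ij M[of i t] M[of i j] by (cases "t = j") (auto simp: J_def)
    next
      show "A $$ (i, j) \<in> (\<lambda>t. A $$ (i, t) + J $$ (t, j)) ` {0..<?n}"
        using ij by (intro image_eqI[of _ _ j]) (auto simp: J_def)
    qed simp
    thus "A $$ (i, j) = (A \<otimes>\<^sub>t J) $$ (i, j)"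
      using ij by (simp add: trop_mult_def J_def)
  qed (auto simp: trop_mult_def J_def)
  moreover have "J \<in> carrier_mat ?n ?n" "A \<in> carrier_mat (dim_row A) ?n"
    by (auto simp: J_def)
  ultimately show ?thesis using assms by blast
qed

text \<open>The entry in row \<open>i\<close> and column \<open>j\<close>, both counted from 1 up to \<open>\<nu> + 6\<close>.\<close>

definition C_entry :: "nat \<Rightarrow> nat \<Rightarrow> nat \<Rightarrow> real" where
  "C_entry \<nu> i j =
    (if i \<le> \<nu> + 1 then
       if j \<le> \<nu> + 2 then
         if (i, j) = (\<nu>, \<nu> + 1) then 20 * real \<nu> - 1
         else if (i, j) = (\<nu> + 1, \<nu> + 1) then 20 * real \<nu> + 11
         else Min {10 * real i + 10 * real j - 10, 20 * real i + 1, 20 * real j - 9}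
       else if j = \<nu> + 3 then 0
       else 2
     else
       if j \<le> \<nu> + 1 then
         if i = \<nu> + 2 then 10 * real j - 3
         else if i = \<nu> + 3 then 11
         else if i = \<nu> + 4 \<or> i = \<nu> + 5 then 2
         else 0
       else
         [[0, 0, 0, 0, 2],
          [0, 0, 2, 0, 2],
          [2, 2, 0, 2, 2],
          [0, 2, 2, 0, 2],
          [0, 2, 2, 2, 0]] ! (i - (\<nu> + 2)) ! (j - (\<nu> + 2)))"

text \<open>Matrix indices in the library start at 0, hence the shift.\<close>

definition C_mat :: "nat \<Rightarrow> real mat" where
  "C_mat \<nu> = mat (\<nu> + 6) (\<nu> + 6) (\<lambda>(i, j). C_entry \<nu> (i + 1) (j + 1))"

end

theory Submission imports Defs
begin

text \<open>Write \<open>a, b, c, d, e\<close> for the last five indices \<open>\<nu> + 2, \<dots>, \<nu> + 6\<close>. In a factorization through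
  at most four rank-one terms, each entry is attained by some term, and the entries \<open>(i, j)\<close> and
  \<open>(k, l)\<close> can share a term only if \<open>C\<^sub>i\<^sub>l + C\<^sub>k\<^sub>j \<le> C\<^sub>i\<^sub>j + C\<^sub>k\<^sub>l\<close>. Hence the zeros \<open>(b, b)\<close>, \<open>(c, c)\<close>, \<open>(d, d)\<close>,
  \<open>(e, e)\<close> are attained by four distinct terms \<open>\<beta>, \<gamma>, \<delta>, \<epsilon>\<close>, and there are no others. The staircase
  entries \<open>(u, u)\<close>, \<open>(u, u + 1)\<close> with \<open>u \<le> \<nu>\<close> are all attained by \<open>\<gamma>\<close> only; following the staircase up to
  the lowered entry \<open>(\<nu>, \<nu> + 1)\<close> shows that \<open>\<gamma>\<close> exceeds the entry \<open>(a, 1)\<close>, which leaves \<open>\<delta>\<close> for it.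
  But \<open>\<delta>\<close> also attains \<open>(b, a)\<close>, and this is incompatible with \<open>(a, 1)\<close>.\<close>

lemma trop_mult_index:
  assumes "i < dim_row B" "j < dim_col C"
  shows "(B \<otimes>\<^sub>t C) $$ (i, j) = Min ((\<lambda>t. B $$ (i, t) + C $$ (t, j)) ` {0..<dim_col B})"
  using assms by (simp add: trop_mult_def)

lemma trop_mult_index_le:
  assumes "i < dim_row B" "j < dim_col C" "t < dim_col B"
  shows "(B \<otimes>\<^sub>t C) $$ (i, j) \<le> B $$ (i, t) + C $$ (t, j)"
  using assms by (simp add: trop_mult_index)

lemma trop_mult_index_attained:
  assumes "i < dim_row B" "j < dim_col C" "dim_col B > 0"
  shows "\<exists>t < dim_col B. (B \<otimes>\<^sub>t C) $$ (i, j) = B $$ (i, t) + C $$ (t, j)"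
proof -
  have "(B \<otimes>\<^sub>t C) $$ (i, j) \<in> (\<lambda>t. B $$ (i, t) + C $$ (t, j)) ` {0..<dim_col B}"
    using assms by (simp only: trop_mult_index) (rule Min_in, auto)
  thus ?thesis by auto
qed

text \<open>At \<open>u = \<nu>\<close> the general formula would give \<open>20 * \<nu>\<close> and
  \<open>20 * \<nu> + 10\<close> for the two exceptional entries; the first is lowered by 1 and gets
  its own item, the second is raised by 1, hence only a bound in the fifth item.\<close>

lemma C_entry_staircase:
  shows "1 \<le> u \<Longrightarrow> u \<le> \<nu> \<Longrightarrow> C_entry \<nu> u u = 20 * real u - 10"
    and "1 \<le> u \<Longrightarrow> u < \<nu> \<Longrightarrow> C_entry \<nu> u (u + 1) = 20 * real u"
    and "C_entry \<nu> \<nu> (\<nu> + 1) = 20 * real \<nu> - 1"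
    and "1 \<le> u \<Longrightarrow> u \<le> \<nu> \<Longrightarrow> C_entry \<nu> (u + 1) u = 20 * real u - 9"
    and "1 \<le> u \<Longrightarrow> u \<le> \<nu> \<Longrightarrow> C_entry \<nu> (u + 1) (u + 1) \<ge> 20 * real u + 10"
    and "1 \<le> u \<Longrightarrow> u \<le> \<nu> \<Longrightarrow> C_entry \<nu> u (\<nu> + 2) = 20 * real u + 1"
    and "C_entry \<nu> (\<nu> + 1) (\<nu> + 2) = 20 * real \<nu> + 20"
  by (auto simp: C_entry_def)

lemma C_entry_border:
  shows "1 \<le> u \<Longrightarrow> u \<le> \<nu> + 1 \<Longrightarrow> C_entry \<nu> u (\<nu> + 3) = 0"
    and "1 \<le> u \<Longrightarrow> u \<le> \<nu> + 1 \<Longrightarrow> C_entry \<nu> u (\<nu> + 4) = 2"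
    and "1 \<le> u \<Longrightarrow> u \<le> \<nu> + 1 \<Longrightarrow> C_entry \<nu> u (\<nu> + 5) = 2"
    and "1 \<le> u \<Longrightarrow> u \<le> \<nu> + 1 \<Longrightarrow> C_entry \<nu> u (\<nu> + 6) = 2"
    and "1 \<le> u \<Longrightarrow> u \<le> \<nu> + 1 \<Longrightarrow> C_entry \<nu> (\<nu> + 2) u = 10 * real u - 3"
    and "1 \<le> u \<Longrightarrow> u \<le> \<nu> + 1 \<Longrightarrow> C_entry \<nu> (\<nu> + 3) u = 11"
    and "1 \<le> u \<Longrightarrow> u \<le> \<nu> + 1 \<Longrightarrow> C_entry \<nu> (\<nu> + 4) u = 2"
    and "1 \<le> u \<Longrightarrow> u \<le> \<nu> + 1 \<Longrightarrow> C_entry \<nu> (\<nu> + 5) u = 2"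
    and "1 \<le> u \<Longrightarrow> u \<le> \<nu> + 1 \<Longrightarrow> C_entry \<nu> (\<nu> + 6) u = 0"
  by (auto simp: C_entry_def)

lemma C_entry_corner:
  shows "C_entry \<nu> (\<nu> + 2) (\<nu> + 2) = 0" "C_entry \<nu> (\<nu> + 2) (\<nu> + 3) = 0"
    "C_entry \<nu> (\<nu> + 2) (\<nu> + 4) = 0" "C_entry \<nu> (\<nu> + 2) (\<nu> + 5) = 0"
    "C_entry \<nu> (\<nu> + 2) (\<nu> + 6) = 2"
    "C_entry \<nu> (\<nu> + 3) (\<nu> + 2) = 0" "C_entry \<nu> (\<nu> + 3) (\<nu> + 3) = 0"
    "C_entry \<nu> (\<nu> + 3) (\<nu> + 4) = 2" "C_entry \<nu> (\<nu> + 3) (\<nu> + 5) = 0"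
    "C_entry \<nu> (\<nu> + 3) (\<nu> + 6) = 2"
    "C_entry \<nu> (\<nu> + 4) (\<nu> + 2) = 2" "C_entry \<nu> (\<nu> + 4) (\<nu> + 3) = 2"
    "C_entry \<nu> (\<nu> + 4) (\<nu> + 4) = 0" "C_entry \<nu> (\<nu> + 4) (\<nu> + 5) = 2"
    "C_entry \<nu> (\<nu> + 4) (\<nu> + 6) = 2"
    "C_entry \<nu> (\<nu> + 5) (\<nu> + 2) = 0" "C_entry \<nu> (\<nu> + 5) (\<nu> + 3) = 2"
    "C_entry \<nu> (\<nu> + 5) (\<nu> + 4) = 2" "C_entry \<nu> (\<nu> + 5) (\<nu> + 5) = 0"
    "C_entry \<nu> (\<nu> + 5) (\<nu> + 6) = 2"
    "C_entry \<nu> (\<nu> + 6) (\<nu> + 2) = 0" "C_entry \<nu> (\<nu> + 6) (\<nu> + 3) = 2"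
    "C_entry \<nu> (\<nu> + 6) (\<nu> + 4) = 2" "C_entry \<nu> (\<nu> + 6) (\<nu> + 5) = 2"
    "C_entry \<nu> (\<nu> + 6) (\<nu> + 6) = 0"
  by (simp_all add: C_entry_def)

text \<open>All that matters about a min-plus product is that no term falls below an entry and some
  term meets it. This form allows any finite index set and keeps the numbering from 1.\<close>

lemma C_entry_no_four_terms:
  fixes x :: "nat \<Rightarrow> 'a \<Rightarrow> real" and y :: "'a \<Rightarrow> nat \<Rightarrow> real"
  assumes nu: "\<nu> > 1" and T: "finite T" "card T \<le> 4"
    and le: "\<And>i j t. i \<in> {1..\<nu> + 6} \<Longrightarrow> j \<in> {1..\<nu> + 6} \<Longrightarrow> t \<in> T \<Longrightarrow> C_entry \<nu> i j \<le> x i t + y t j"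
    and attained: "\<And>i j. i \<in> {1..\<nu> + 6} \<Longrightarrow> j \<in> {1..\<nu> + 6} \<Longrightarrow> \<exists>t\<in>T. C_entry \<nu> i j = x i t + y t j"
  shows False
proof -
  define a b c d e where idx: "a = \<nu> + 2" "b = \<nu> + 3" "c = \<nu> + 4" "d = \<nu> + 5" "e = \<nu> + 6"
  define I where "I = {1..\<nu> + 6}"
  define A where "A = C_entry \<nu>"
  define att where "att i j t \<longleftrightarrow> A i j = x i t + y t j" for i j t
  note staircase = C_entry_staircase[where \<nu> = \<nu>, folded A_def idx]
  note border = C_entry_border[where \<nu> = \<nu>, folded A_def idx]
  note corner = C_entry_corner[where \<nu> = \<nu>, folded A_def idx]
  have I: "a \<in> I" "b \<in> I" "c \<in> I" "d \<in> I" "e \<in> I"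
    "\<And>u. 1 \<le> u \<Longrightarrow> u \<le> \<nu> + 1 \<Longrightarrow> u \<in> I"
    by (auto simp: I_def idx)
  have le: "A i j \<le> x i t + y t j" if "i \<in> I" "j \<in> I" "t \<in> T" for i j t
    using that le by (simp add: A_def I_def)
  have attained: "\<exists>t\<in>T. att i j t" if "i \<in> I" "j \<in> I" for i j
    using that attained by (simp add: A_def I_def att_def)
  \<comment> \<open>Swapping the columns of two entries attained by \<open>t\<close> leaves the sum
    of the four summands \<open>x\<close>, \<open>y\<close> unchanged, and \<open>le\<close> bounds
    it below at the swapped positions.\<close>
  have exchange: "A i l + A k j \<le> A i j + A k l"
    if "att i j t" "att k l t" "t \<in> T" "i \<in> I" "j \<in> I" "k \<in> I" "l \<in> I" for i j k l t
    using that le[of i l t] le[of k j t] by (simp add: att_def)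

  from attained I obtain \<beta> \<gamma> \<delta> \<epsilon> where
    diag: "att b b \<beta>" "att c c \<gamma>" "att d d \<delta>" "att e e \<epsilon>" and
    mem: "\<beta> \<in> T" "\<gamma> \<in> T" "\<delta> \<in> T" "\<epsilon> \<in> T" by metis
  \<comment> \<open>For any two of \<open>b, c, d, e\<close> the two off-diagonal entries have
    positive sum.\<close>
  have "distinct [\<beta>, \<gamma>, \<delta>, \<epsilon>]"
    using exchange[of b b \<beta> c c] exchange[of b b \<beta> d d] exchange[of b b \<beta> e e]
      exchange[of c c \<gamma> d d] exchange[of c c \<gamma> e e] exchange[of d d \<delta> e e] diag mem I
    by (auto simp: corner)
  then have "card {\<beta>, \<gamma>, \<delta>, \<epsilon>} = 4" by simp
  with T mem have Teq: "T = {\<beta>, \<gamma>, \<delta>, \<epsilon>}"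
    by (metis card_seteq empty_subsetI insert_subset)
  have cases: "att i j \<beta> \<or> att i j \<gamma> \<or> att i j \<delta> \<or> att i j \<epsilon>" if "i \<in> I" "j \<in> I" for i j
    using attained[OF that] Teq by blast
  have forbid\<beta>: "\<not> att i j \<beta>" if "A i b + A b j > A i j" "i \<in> I" "j \<in> I" for i j
    using exchange[of i j \<beta> b b] that diag mem I by (auto simp: corner)
  have forbid\<gamma>: "\<not> att i j \<gamma>" if "A i c + A c j > A i j" "i \<in> I" "j \<in> I" for i j
    using exchange[of i j \<gamma> c c] that diag mem I by (auto simp: corner)
  have forbid\<delta>: "\<not> att i j \<delta>" if "A i d + A d j > A i j" "i \<in> I" "j \<in> I" for i j
    using exchange[of i j \<delta> d d] that diag mem I by (auto simp: corner)
  have forbid\<epsilon>: "\<not> att i j \<epsilon>" if "A i e + A e j > A i j" "i \<in> I" "j \<in> I" for i j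
    using exchange[of i j \<epsilon> e e] that diag mem I by (auto simp: corner)
  note forbid = forbid\<beta> forbid\<gamma> forbid\<delta> forbid\<epsilon>

  \<comment> \<open>Each of the following entries is 0, and exchange with the diagonal zeros rules
    out all terms but one.\<close>
  have ub: "att u b \<beta>" if "1 \<le> u" "u \<le> \<nu> + 1" for u
    using cases[of u b] forbid[of u b] that I by (auto simp: corner border)
  have ev: "att e v \<epsilon>" if "1 \<le> v" "v \<le> \<nu> + 1" for v
    using cases[of e v] forbid[of e v] that I by (auto simp: corner border)
  have ea: "att e a \<epsilon>"
    using cases[of e a] forbid[of e a] I by (auto simp: corner)
  have da: "att d a \<delta>"
    using cases[of d a] forbid[of d a] I by (auto simp: corner)
  have ac: "att a c \<gamma>"
    using cases[of a c] forbid[of a c] I by (auto simp: corner)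

  \<comment> \<open>Since \<open>A u b = A w b = 0\<close>, \<open>\<beta>\<close> can only attain
    the maximum of column \<open>v\<close> over the first \<open>\<nu> + 1\<close> rows.\<close>
  have not_\<beta>: "\<not> att u v \<beta>"
    if "A w v > A u v" "1 \<le> u" "u \<le> \<nu> + 1" "1 \<le> w" "w \<le> \<nu> + 1" "v \<in> I" for u v w
    using exchange[of u v \<beta> w b] ub[of w] that mem I by (auto simp: border)
  have not_\<epsilon>: "\<not> att u v \<epsilon>"
    if "A u a > A u v" "u \<in> I" "1 \<le> v" "v \<le> \<nu> + 1" for u v
    using exchange[of u v \<epsilon> e a] ea that mem I by (auto simp: border corner)
  have not_\<delta>: "\<not> att u v \<delta>"
    if "A u a > A u v" "u \<in> I" "1 \<le> v" "v \<le> \<nu> + 1" for u v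
    using exchange[of u v \<delta> d a] da that mem I by (auto simp: border corner)

  have uu: "att u u \<gamma>" if "1 \<le> u" "u \<le> \<nu>" for u
    using cases[of u u] not_\<beta>[of u u "u + 1"] not_\<delta>[of u u] not_\<epsilon>[of u u] that I
    by (auto simp: staircase[simplified])
  have le20: "A u (u + 1) \<le> 20 * real u" if "1 \<le> u" "u \<le> \<nu>" for u
    using that staircase(2)[of u] staircase(3) by (cases "u = \<nu>") auto
  have us: "att u (u + 1) \<gamma>" if u: "1 \<le> u" "u \<le> \<nu>" for u
  proof -
    have "A (u + 1) (u + 1) > A u (u + 1)" "A u a > A u (u + 1)"
      using le20[OF u] staircase(5,6)[OF u] by auto
    thus ?thesis
      using cases[of u "u + 1"] not_\<beta>[of u "u + 1" "u + 1"] not_\<delta>[of u "u + 1"]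
        not_\<epsilon>[of u "u + 1"] u I by auto
  qed
  \<comment> \<open>The entries \<open>(u, u)\<close> and \<open>(u, u + 1)\<close> share
    \<open>x u \<gamma>\<close>, so their difference 10 is the increment of
    \<open>y \<gamma>\<close>.\<close>
  have "v \<le> \<nu> \<Longrightarrow> y \<gamma> v = y \<gamma> 1 + 10 * (real v - 1)" if "1 \<le> v" for v
    using that
  proof (induction v rule: dec_induct)
    case (step u)
    then show ?case
      using uu[of u] us[of u] staircase(1,2)[of u] by (simp add: att_def)
  qed simp
  \<comment> \<open>The lowered entry makes the last increment 9 instead of 10.\<close>
  from this[of \<nu>] have "y \<gamma> (\<nu> + 1) = y \<gamma> 1 + 10 * real \<nu> - 1"
    using nu uu[of \<nu>] us[of \<nu>] staircase(1)[of \<nu>] staircase(3) by (simp add: att_def)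
  \<comment> \<open>Here \<open>A a (\<nu> + 1) = 10 * \<nu> + 7\<close>. The lost unit lifts the
    bound from 7, which equals \<open>A a 1\<close>, to 8.\<close>
  with le[of a "\<nu> + 1" \<gamma>] have "x a \<gamma> + y \<gamma> 1 \<ge> 8"
    using mem I nu border(5)[of "\<nu> + 1"] by simp
  then have "\<not> att a 1 \<gamma>"
    using border(5)[of 1] by (simp add: att_def)
  moreover have "\<not> att a 1 \<epsilon>"
    using exchange[of a 1 \<epsilon> e 2] ev[of 2] mem I nu border(5)[of 1] border(5)[of 2]
      border(9)[of 1] border(9)[of 2] by auto
  ultimately have "att a 1 \<delta>"
    using cases[of a 1] forbid(1)[of a 1] I border(5,6)[of 1] by (auto simp: corner)
  \<comment> \<open>To exclude \<open>\<beta>\<close>, compare with the zero at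
    \<open>(\<nu> + 1, b)\<close>: the crossed entry \<open>A (\<nu> + 1) a\<close> is
    \<open>20 * \<nu> + 20\<close>.\<close>
  moreover have "att b a \<delta>"
    using cases[of b a] forbid(2,4)[of b a] exchange[of b a \<beta> "\<nu> + 1" b] ub[of "\<nu> + 1"] mem I
      staircase(7) border(1)[of "\<nu> + 1"] by (auto simp: corner)
  \<comment> \<open>Exchange would require \<open>A a a + A b 1 = 11\<close> to be at most
    \<open>A a 1 + A b a = 7\<close>.\<close>
  ultimately show False
    using exchange[of a 1 \<delta> b a] mem I border(5,6)[of 1] by (auto simp: corner)
qed

theorem theorem5p2:
  fixes \<nu> :: nat
  assumes "\<nu> > 1"
  shows "factor_rank (C_mat \<nu>) > 4"
proof (rule ccontr)
  let ?k = "factor_rank (C_mat \<nu>)"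
  assume "\<not> ?k > 4"
  have dim: "dim_row (C_mat \<nu>) = \<nu> + 6" "dim_col (C_mat \<nu>) = \<nu> + 6"
    by (simp_all add: C_mat_def)
  have "?k > 0 \<and> (\<exists>B \<in> carrier_mat (dim_row (C_mat \<nu>)) ?k.
      \<exists>D \<in> carrier_mat ?k (dim_col (C_mat \<nu>)). C_mat \<nu> = B \<otimes>\<^sub>t D)"
    unfolding factor_rank_def by (rule LeastI_ex) (use factor_rank_witness[of "C_mat \<nu>"] dim in auto)
  then obtain B D where k: "?k > 0" and B: "B \<in> carrier_mat (\<nu> + 6) ?k"
    and D: "D \<in> carrier_mat ?k (\<nu> + 6)" and eq: "C_mat \<nu> = B \<otimes>\<^sub>t D"
    using dim by auto
  have less: "i - 1 < \<nu> + 6" if "i \<in> {1..\<nu> + 6}" for i :: nat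
    using that by auto
  have entry: "C_entry \<nu> i j = (B \<otimes>\<^sub>t D) $$ (i - 1, j - 1)"
    if "i \<in> {1..\<nu> + 6}" "j \<in> {1..\<nu> + 6}" for i j
    using that less[OF that(1)] less[OF that(2)] by (simp add: eq[symmetric] C_mat_def)
  show False
  proof (rule C_entry_no_four_terms[of \<nu> "{..<?k}" "\<lambda>i t. B $$ (i - 1, t)" "\<lambda>t j. D $$ (t, j - 1)"])
    fix i j assume ij: "i \<in> {1..\<nu> + 6}" "j \<in> {1..\<nu> + 6}"
    show "\<exists>t\<in>{..<?k}. C_entry \<nu> i j = B $$ (i - 1, t) + D $$ (t, j - 1)"
      using trop_mult_index_attained[of "i - 1" B "j - 1" D] less[OF ij(1)] less[OF ij(2)] entry[OF ij] B D k
      by auto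
    fix t assume "t \<in> {..<?k}"
    thus "C_entry \<nu> i j \<le> B $$ (i - 1, t) + D $$ (t, j - 1)"
      using trop_mult_index_le[of "i - 1" B "j - 1" D t] less[OF ij(1)] less[OF ij(2)] entry[OF ij] B D by auto
  qed (use assms \<open>\<not> ?k > 4\<close> in auto)
qed

end
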